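(* Consider a DC power network with fixed topology, susceptances, limit vector $\xi\in\Omega$ and cost vector $f\in\Omega_f(\xi)$, such that the regularity assumption (R) holds (all notions as defined in the context). For any load vector $s^l\in\widetilde\Omega_s(\xi)$ such that $\mathcal{S}_B(s^l)\subseteq\mathcal{E}^{\rm I}$, we have $\partial_{s^l}\mathcal{OPF}(s^l)\ge 0$ (entrywise, as an $N_G\times N_L$ matrix), i.e., the system is monotone.
   Context: Network. $\mathcal{G}(\mathcal{V},\mathcal{E})$ is a connected undirected graph with $\mathcal{V}=\mathcal{V}_G\cup\mathcal{V}_L$, $\mathcal{V}_G=\{1,\dots,N_G\}$ (generators), $\mathcal{V}_L=\{N_G+1,\dots,N_G+N_L\}$ (loads; disjoint from the generators), $N=N_G+N_L$, and edges (branches) labelled $1,\dots,E$. $C\in\mathbb{R}^{N\times E}$ is the signed incidence matrix, $B=\mathrm{diag}(b_1,\dots,b_E)$ with all susceptances $b_e>0$. Vector and matrix inequalities are entrywise. $\|x\|_0$ is the number of nonzero entries of $x$. DC OPF. The limit vector is $\xi=(\overline{s}^g,\underline{s}^g,\overline{p},\underline{p})\in\mathbb{R}^{2N_G+2E}$, always with $\overline{s}^g>\underline{s}^g$ and $\overline{p}>\underline{p}$. Given loads $s^l\in\mathbb{R}^{N_L}$ ($s^l_i$ is the load at bus $N_G+i$) and cost vector $f\in\mathbb{R}^{N_G}$, the problem is to minimize $f^{\mathsf T}s^g$ over $s^g\in\mathbb{R}^{N_G}$, $\theta\in\mathbb{R}^N$ subject to (i) $\theta_1=0$; (ii) $CBC^{\mathsf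 T}\theta=\begin{bmatrix}s^g\\-s^l\end{bmatrix}$; (iii) $\underline{s}^g\le s^g\le\overline{s}^g$; (iv) $\underline{p}\le BC^{\mathsf T}\theta\le\overline{p}$. The branch flows are $p=BC^{\mathsf T}\theta$. Sets. $\Omega$ is the set of limit vectors $\xi$ with $\underline{s}^g\ge0$ for which (i)-(iv) is feasible for some $s^l>0$. For $\xi\in\Omega$, $\Omega_s(\xi)$ is the set of $s^l>0$ for which (i)-(iv) is feasible, and $\widetilde\Omega_s(\xi)$ is the set of $s^l\in\Omega_s(\xi)$ for which the DC OPF has $N_G-1$ binding inequality constraints (at its optimal solution). KKT conditions. With $M=\begin{bmatrix}CBC^{\mathsf T}\\ 1\;0\;\cdots\;0\end{bmatrix}\in\mathbb{R}^{(N+1)\times N}$ and multipliers $\tau\in\mathbb{R}^{N+1}$, $\lambda_+,\lambda_-\in\mathbb{R}^{N_G}$, $\mu_+,\mu_-\in\mathbb{R}^E$, they are: (i)-(iv); $0=M^{\mathsf T}\tau+CB(\mu_+-\mu_-)$; $-f=-(\tau_1,\dots,\tau_{N_G})^{\mathsf T}+\lambda_+-\lambda_-$; $\mu_\pm,\lambda_\pm\ge0$; $\mu_+^{\mathsf T}(BC^{\mathsf T}\theta-\overline{p})=\mu_-^{\mathsf T}(\underline{p}-BC^{\mathsf T}\theta)=0$; $\lambda_+^{\mathsf T}(s^g-\overline{s}^g)=\lambda_-^{\mathsf T}(\underline{s}^g-s^g)=0$. $\Omega_f(\xi)$ is the set of $f\in\mathbb{R}^{N_G}$ such that for all $s^l\in\Omega_s(\xi)$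 the DC OPF has a unique solution and the Lagrange multipliers of the KKT conditions satisfy $\|\mu_+\|_0+\|\mu_-\|_0+\|\lambda_+\|_0+\|\lambda_-\|_0\ge N_G-1$. For $f\in\Omega_f(\xi)$, $\mathcal{OPF}:\Omega_s(\xi)\to\mathbb{R}^{N_G}$ maps $s^l$ to the unique optimal $s^g$, and $\partial_{s^l}\mathcal{OPF}(s^l)\in\mathbb{R}^{N_G\times N_L}$ denotes its derivative at $s^l$. Binding sets. At the optimal solution for $s^l$, $\mathcal{S}_G(s^l)=\{i\in\mathcal{V}_G: s^g_i\in\{\underline{s}^g_i,\overline{s}^g_i\}\}$ and $\mathcal{S}_B(s^l)=\{e\in\mathcal{E}:p_e\in\{\underline{p}_e,\overline{p}_e\}\}$. (R): $\widetilde\Omega_s(\xi)$ is dense in $\Omega_s(\xi)$, and for every $s^l\in\widetilde\Omega_s(\xi)$ the derivative $\partial_{s^l}\mathcal{OPF}(s^l)$ exists and the sets $\mathcal{S}_G,\mathcal{S}_B$ do not change in a neighborhood of $s^l$. Bridges. $\mathcal{E}^{\rm I}=\{e\in\mathcal{E}:\mathcal{G}(\mathcal{V},\mathcal{E}\setminus\{e\})\text{ is not connected}\}$. Monotone. The system is monotone if for all $\alpha,\beta\in\Omega_s(\xi)$ with $\alpha\ge\beta$ and $\|\alpha-\beta\|_0=1$, one has $\mathcal{OPF}(\alpha)\ge\mathcal{OPF}(\beta)$; the source uses as an equivalent definition that the derivative $\partial_{s^l}\mathcal{OPF}(s^l)$ is entrywise nonnegative (when it exists). *)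

theory Defs
  imports "HOL-Analysis.Analysis" "Graph_Theory.Digraph_Component"
begin

text \<open>
  Generators, loads and branches are indexed by finite types \<open>'g\<close>, \<open>'l\<close>, \<open>'e\<close>; buses are the
  disjoint union \<open>'g + 'l\<close>, generators first. The undirected network graph is represented by an
  orientation of it (needed anyway for the signed incidence matrix), and
  \<open>Digraph_Component.connected\<close> is connectedness of the underlying undirected graph. The field
  \<open>ref_gen\<close> is the generator bus called 1 in the source, whose phase angle is fixed to 0.
\<close>

record ('g, 'l, 'e) power_net =
  grid :: "('g + 'l, 'e) pre_digraph"
  suscept :: "'e \<Rightarrow> real"
  ref_gen :: 'g

definition dc_network :: "('g::finite, 'l::finite, 'e::finite) power_net \<Rightarrow> bool" where
  "dc_network net \<longleftrightarrow>
     verts (grid net) = UNIV \<and> arcs (grid net) = UNIV \<and> loopfree_digraph (grid net) \<and>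
     Digraph_Component.connected (grid net) \<and> (\<forall>e. suscept net e > 0)"

definition bridges :: "('g::finite, 'l::finite, 'e::finite) power_net \<Rightarrow> 'e set" where
  "bridges net = {e. \<not> Digraph_Component.connected (pre_digraph.del_arc (grid net) e)}"

definition C_mat :: "('g::finite, 'l::finite, 'e::finite) power_net \<Rightarrow> real^'e^('g + 'l)" where
  "C_mat net = (\<chi> v e. if v = tail (grid net) e then 1
                       else if v = head (grid net) e then -1 else 0)"

definition B_mat :: "('g::finite, 'l::finite, 'e::finite) power_net \<Rightarrow> real^'e^'e" where
  "B_mat net = (\<chi> e e'. if e = e' then suscept net e else 0)"

definition laplacian :: "('g::finite, 'l::finite, 'e::finite) power_net \<Rightarrow> real^('g + 'l)^('g + 'l)" where
  "laplacian net = C_mat net ** B_mat net ** transpose (C_mat net)"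

definition branch_flow :: "('g::finite, 'l::finite, 'e::finite) power_net \<Rightarrow> real^('g + 'l) \<Rightarrow> real^'e" where
  "branch_flow net \<theta> = (B_mat net ** transpose (C_mat net)) *v \<theta>"

definition injection :: "real^'g \<Rightarrow> real^'l \<Rightarrow> real^('g::finite + 'l::finite)" where
  "injection sg sl = (\<chi> v. case v of Inl i \<Rightarrow> sg $ i | Inr j \<Rightarrow> - (sl $ j))"

text \<open>
  The library order \<open><\<close> on vectors is not the entrywise strict order (it is \<open>x \<le> y \<and> x \<noteq> y\<close>), so
  strict entrywise inequalities get their own definition; \<open>\<le>\<close> is entrywise.
\<close>

definition vless :: "real^'n::finite \<Rightarrow> real^'n \<Rightarrow> bool" where
  "vless x y \<longleftrightarrow> (\<forall>i. x $ i < y $ i)"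

definition norm0 :: "real^'n::finite \<Rightarrow> nat" where
  "norm0 x = card {i. x $ i \<noteq> 0}"

record ('g, 'e) limits =
  sg_max :: "real^'g"
  sg_min :: "real^'g"
  p_max :: "real^'e"
  p_min :: "real^'e"

subsection \<open>The DC optimal power flow problem\<close>

definition opf_feasible ::
  "('g::finite, 'l::finite, 'e::finite) power_net \<Rightarrow> ('g, 'e) limits \<Rightarrow> real^'l \<Rightarrow>
   (real^'g) \<times> (real^('g + 'l)) \<Rightarrow> bool" where
  "opf_feasible net \<xi> sl = (\<lambda>(sg, \<theta>).
     \<theta> $ Inl (ref_gen net) = 0 \<and>
     laplacian net *v \<theta> = injection sg sl \<and>
     sg_min \<xi> \<le> sg \<and> sg \<le> sg_max \<xi> \<and>
     p_min \<xi> \<le> branch_flow net \<theta> \<and> branch_flow net \<theta> \<le> p_max \<xi>)"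

definition opf_optimal ::
  "('g::finite, 'l::finite, 'e::finite) power_net \<Rightarrow> ('g, 'e) limits \<Rightarrow> real^'g \<Rightarrow> real^'l \<Rightarrow>
   (real^'g) \<times> (real^('g + 'l)) \<Rightarrow> bool" where
  "opf_optimal net \<xi> f sl x \<longleftrightarrow>
     opf_feasible net \<xi> sl x \<and> (\<forall>y. opf_feasible net \<xi> sl y \<longrightarrow> f \<bullet> fst x \<le> f \<bullet> fst y)"

definition Omega :: "('g::finite, 'l::finite, 'e::finite) power_net \<Rightarrow> ('g, 'e) limits set" where
  "Omega net = {\<xi>. vless (sg_min \<xi>) (sg_max \<xi>) \<and> vless (p_min \<xi>) (p_max \<xi>) \<and> 0 \<le> sg_min \<xi> \<and>
                   (\<exists>sl. vless 0 sl \<and> (\<exists>x. opf_feasible net \<xi> sl x))}"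

definition Omega_s ::
  "('g::finite, 'l::finite, 'e::finite) power_net \<Rightarrow> ('g, 'e) limits \<Rightarrow> (real^'l) set" where
  "Omega_s net \<xi> = {sl. vless 0 sl \<and> (\<exists>x. opf_feasible net \<xi> sl x)}"

text \<open>KKT conditions; the rows of \<open>M\<close> are the buses (\<open>Some v\<close>) and one extra row (\<open>None\<close>).\<close>

definition M_mat ::
  "('g::finite, 'l::finite, 'e::finite) power_net \<Rightarrow> real^('g + 'l)^('g + 'l) option" where
  "M_mat net = (\<chi> r. case r of Some v \<Rightarrow> laplacian net $ v | None \<Rightarrow> axis (Inl (ref_gen net)) 1)"

definition KKT ::
  "('g::finite, 'l::finite, 'e::finite) power_net \<Rightarrow> ('g, 'e) limits \<Rightarrow> real^'g \<Rightarrow> real^'l \<Rightarrow>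
   real^'g \<Rightarrow> real^('g + 'l) \<Rightarrow> real^('g + 'l) option \<Rightarrow>
   real^'g \<Rightarrow> real^'g \<Rightarrow> real^'e \<Rightarrow> real^'e \<Rightarrow> bool" where
  "KKT net \<xi> f sl sg \<theta> \<tau> lam_p lam_m mu_p mu_m \<longleftrightarrow>
     opf_feasible net \<xi> sl (sg, \<theta>) \<and>
     0 = transpose (M_mat net) *v \<tau> + (C_mat net ** B_mat net) *v (mu_p - mu_m) \<and>
     - f = - (\<chi> i. \<tau> $ Some (Inl i)) + lam_p - lam_m \<and>
     0 \<le> mu_p \<and> 0 \<le> mu_m \<and> 0 \<le> lam_p \<and> 0 \<le> lam_m \<and>
     mu_p \<bullet> (branch_flow net \<theta> - p_max \<xi>) = 0 \<and>
     mu_m \<bullet> (p_min \<xi> - branch_flow net \<theta>) = 0 \<and>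
     lam_p \<bullet> (sg - sg_max \<xi>) = 0 \<and>
     lam_m \<bullet> (sg_min \<xi> - sg) = 0"

definition Omega_f ::
  "('g::finite, 'l::finite, 'e::finite) power_net \<Rightarrow> ('g, 'e) limits \<Rightarrow> (real^'g) set" where
  "Omega_f net \<xi> = {f. \<forall>sl \<in> Omega_s net \<xi>.
     (\<exists>!x. opf_optimal net \<xi> f sl x) \<and>
     (\<forall>sg \<theta> \<tau> lam_p lam_m mu_p mu_m.
        KKT net \<xi> f sl sg \<theta> \<tau> lam_p lam_m mu_p mu_m \<longrightarrow>
        norm0 mu_p + norm0 mu_m + norm0 lam_p + norm0 lam_m \<ge> CARD('g) - 1)}"

subsection \<open>The OPF operator\<close>

text \<open>
  \<open>opf_sol\<close> is meaningful for \<open>f \<in> Omega_f net \<xi>\<close> and \<open>sl \<in> Omega_s net \<xi>\<close>, where the optimal solution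
  \<open>(sg, \<theta>)\<close> exists and is unique.
\<close>

definition opf_sol ::
  "('g::finite, 'l::finite, 'e::finite) power_net \<Rightarrow> ('g, 'e) limits \<Rightarrow> real^'g \<Rightarrow> real^'l \<Rightarrow>
   (real^'g) \<times> (real^('g + 'l))" where
  "opf_sol net \<xi> f sl = (THE x. opf_optimal net \<xi> f sl x)"

definition OPF ::
  "('g::finite, 'l::finite, 'e::finite) power_net \<Rightarrow> ('g, 'e) limits \<Rightarrow> real^'g \<Rightarrow> real^'l \<Rightarrow> real^'g" where
  "OPF net \<xi> f sl = fst (opf_sol net \<xi> f sl)"

definition opt_flow ::
  "('g::finite, 'l::finite, 'e::finite) power_net \<Rightarrow> ('g, 'e) limits \<Rightarrow> real^'g \<Rightarrow> real^'l \<Rightarrow> real^'e" where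
  "opt_flow net \<xi> f sl = branch_flow net (snd (opf_sol net \<xi> f sl))"

text \<open>
  The derivative is taken within the domain \<open>Omega_s\<close> of the operator, so that the values of \<open>OPF\<close>
  outside of its domain play no role.
\<close>

definition dOPF ::
  "('g::finite, 'l::finite, 'e::finite) power_net \<Rightarrow> ('g, 'e) limits \<Rightarrow> real^'g \<Rightarrow> real^'l \<Rightarrow> real^'l^'g" where
  "dOPF net \<xi> f sl = jacobian (OPF net \<xi> f) (at sl within Omega_s net \<xi>)"

definition S_G ::
  "('g::finite, 'l::finite, 'e::finite) power_net \<Rightarrow> ('g, 'e) limits \<Rightarrow> real^'g \<Rightarrow> real^'l \<Rightarrow> 'g set" where
  "S_G net \<xi> f sl = {i. OPF net \<xi> f sl $ i \<in> {sg_min \<xi> $ i, sg_max \<xi> $ i}}"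

definition S_B ::
  "('g::finite, 'l::finite, 'e::finite) power_net \<Rightarrow> ('g, 'e) limits \<Rightarrow> real^'g \<Rightarrow> real^'l \<Rightarrow> 'e set" where
  "S_B net \<xi> f sl = {e. opt_flow net \<xi> f sl $ e \<in> {p_min \<xi> $ e, p_max \<xi> $ e}}"

definition num_binding ::
  "('g::finite, 'l::finite, 'e::finite) power_net \<Rightarrow> ('g, 'e) limits \<Rightarrow> real^'g \<Rightarrow> real^'l \<Rightarrow> nat" where
  "num_binding net \<xi> f sl =
     card {i. OPF net \<xi> f sl $ i = sg_min \<xi> $ i} + card {i. OPF net \<xi> f sl $ i = sg_max \<xi> $ i} +
     card {e. opt_flow net \<xi> f sl $ e = p_min \<xi> $ e} + card {e. opt_flow net \<xi> f sl $ e = p_max \<xi> $ e}"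

definition Omega_s_tilde ::
  "('g::finite, 'l::finite, 'e::finite) power_net \<Rightarrow> ('g, 'e) limits \<Rightarrow> real^'g \<Rightarrow> (real^'l) set" where
  "Omega_s_tilde net \<xi> f = {sl \<in> Omega_s net \<xi>. num_binding net \<xi> f sl = CARD('g) - 1}"

definition regularity ::
  "('g::finite, 'l::finite, 'e::finite) power_net \<Rightarrow> ('g, 'e) limits \<Rightarrow> real^'g \<Rightarrow> bool" where
  "regularity net \<xi> f \<longleftrightarrow>
     Omega_s net \<xi> \<subseteq> closure (Omega_s_tilde net \<xi> f) \<and>
     (\<forall>sl \<in> Omega_s_tilde net \<xi> f.
        OPF net \<xi> f differentiable (at sl within Omega_s net \<xi>) \<and>
        (\<forall>\<^sub>F sl' in at sl within Omega_s net \<xi>.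
           S_G net \<xi> f sl' = S_G net \<xi> f sl \<and> S_B net \<xi> f sl' = S_B net \<xi> f sl))"

definition monotone_system ::
  "('g::finite, 'l::finite, 'e::finite) power_net \<Rightarrow> ('g, 'e) limits \<Rightarrow> real^'g \<Rightarrow> bool" where
  "monotone_system net \<xi> f \<longleftrightarrow>
     (\<forall>\<alpha> \<in> Omega_s net \<xi>. \<forall>\<beta> \<in> Omega_s net \<xi>.
        \<beta> \<le> \<alpha> \<and> norm0 (\<alpha> - \<beta>) = 1 \<longrightarrow> OPF net \<xi> f \<beta> \<le> OPF net \<xi> f \<alpha>)"

end

theory Submission
  imports Defs
begin

text \<open>
  Uniqueness of the optimum makes the binding constraints rigid: with fixed loads, the generation
  cannot move while keeping all of them binding. If the binding branches are bridges, power could be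
  shifted between two free generators on the same side of all of these bridges, so by rigidity every
  component left after removing the binding bridges has at most one free generator. Balancing power
  over such a component shows that the generation grows with the loads as long as the same
  constraints bind.

  Counting makes the points with \<open>N\<^sub>G - 1\<close> binding constraints interior in the set of feasible
  loads. In the interior the optimum is continuous, because the optimal cost is convex there, and by
  density every binding set contains one of a point of \<open>Omega_s_tilde\<close>. Hence along a segment of
  increasing loads the optimum is a continuous function made of finitely many monotone patches, and
  boundary points are reached along segments into the interior.
\<close>

subsection \<open>Connectedness and cuts\<close>

text \<open>A set that no arc crosses keeps every walk of the symmetrised graph that starts in it,
  and connectedness supplies such walks to all vertices.\<close>

lemma connected_closed_UNIV:
  assumes "Digraph_Component.connected G" "verts G = UNIV"
    and closed: "\<forall>e\<in>arcs G. tail G e \<in> U \<longleftrightarrow> head G e \<in> U" and "u \<in> U"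
  shows "U = UNIV"
proof -
  have "v \<in> U" for v
  proof -
    have reach: "u \<rightarrow>\<^sup>*\<^bsub>with_proj (mk_symmetric G)\<^esub> v"
      using assms(1,2) by (auto simp: Digraph_Component.connected_def strongly_connected_def mk_symmetric_def)
    have wf: "wf_digraph (with_proj (mk_symmetric G))"
      by unfold_locales (auto simp: assms(2) mk_symmetric_def)
    show ?thesis using reach \<open>u \<in> U\<close>
    proof (induct rule: wf_digraph.reachable_induct[OF wf, consumes 1, case_names base step])
      case (step x y)
      then show ?case using closed
        by (auto simp: mk_symmetric_def arcs_ends_def arc_to_ends_def)
    qed auto
  qed
  then show ?thesis by auto
qed

text \<open>The witness is the set of vertices reachable from \<open>u\<close> in the symmetrised
  graph, where \<open>w\<close> is a vertex that \<open>u\<close> fails to reach.\<close>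

lemma not_connected_closed:
  assumes "\<not> Digraph_Component.connected G" "verts G = UNIV"
  obtains U u w where "u \<in> U" "w \<notin> U" "\<And>e. e \<in> arcs G \<Longrightarrow> tail G e \<in> U \<longleftrightarrow> head G e \<in> U"
proof -
  let ?H = "with_proj (mk_symmetric G)"
  obtain u w where uw: "\<not> u \<rightarrow>\<^sup>*\<^bsub>?H\<^esub> w"
    using assms by (auto simp: Digraph_Component.connected_def strongly_connected_def mk_symmetric_def)
  have wf: "wf_digraph ?H"
    by unfold_locales (auto simp: assms(2) mk_symmetric_def)
  have step: "u \<rightarrow>\<^sup>*\<^bsub>?H\<^esub> y" if "u \<rightarrow>\<^sup>*\<^bsub>?H\<^esub> x" "(x, y) \<in> parcs (mk_symmetric G)" for x y
  proof -
    have "x \<rightarrow>\<^bsub>?H\<^esub> y" using that(2) by (force simp: arcs_ends_def arc_to_ends_def)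
    then show ?thesis using that(1) wf_digraph.reachable_adj_trans[OF wf] by blast
  qed
  show thesis
  proof (rule that[of u "{x. u \<rightarrow>\<^sup>*\<^bsub>?H\<^esub> x}" w])
    show "u \<in> {x. u \<rightarrow>\<^sup>*\<^bsub>?H\<^esub> x}"
      using wf_digraph.reachable_refl[OF wf] by (simp add: mk_symmetric_def assms(2))
    show "w \<notin> {x. u \<rightarrow>\<^sup>*\<^bsub>?H\<^esub> x}" using uw by simp
    fix e assume "e \<in> arcs G"
    then have "(tail G e, head G e) \<in> parcs (mk_symmetric G)" "(head G e, tail G e) \<in> parcs (mk_symmetric G)"
      by (auto simp: mk_symmetric_def)
    then show "tail G e \<in> {x. u \<rightarrow>\<^sup>*\<^bsub>?H\<^esub> x} \<longleftrightarrow> head G e \<in> {x. u \<rightarrow>\<^sup>*\<^bsub>?H\<^esub> x}"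
      using step by blast
  qed
qed

text \<open>Deleting a bridge leaves a proper nonempty set that no remaining arc crosses. The bridge
  itself must cross it, since otherwise the full network would be disconnected. The flow on a bridge
  is thus fixed by the net injection on one side.\<close>

lemma bridge_cut:
  assumes net: "dc_network net" and e: "e \<in> bridges net"
  obtains U where "\<And>e'. (tail (grid net) e' \<in> U) \<noteq> (head (grid net) e' \<in> U) \<longleftrightarrow> e' = e"
proof -
  let ?G = "grid net" and ?D = "pre_digraph.del_arc (grid net) e"
  have "\<not> Digraph_Component.connected ?D" "verts ?D = UNIV" and arcs: "arcs ?D = UNIV - {e}"
    "tail ?D = tail ?G" "head ?D = head ?G"
    using net e by (auto simp: bridges_def dc_network_def pre_digraph.del_arc_def)
  from not_connected_closed[OF this(1,2)] obtain U u w where U: "u \<in> U" "w \<notin> U"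
    and cl: "\<And>e'. e' \<in> arcs ?D \<Longrightarrow> tail ?D e' \<in> U \<longleftrightarrow> head ?D e' \<in> U" by metis
  have "(tail ?G e \<in> U) \<noteq> (head ?G e \<in> U)"
  proof
    assume "(tail ?G e \<in> U) = (head ?G e \<in> U)"
    then have "\<forall>e'\<in>arcs ?G. tail ?G e' \<in> U \<longleftrightarrow> head ?G e' \<in> U" using cl arcs by auto
    from connected_closed_UNIV[OF _ _ this U(1)] show False
      using net U(2) by (auto simp: dc_network_def)
  qed
  then show thesis using that[of U] cl arcs by auto
qed

subsection \<open>The weighted Laplacian\<close>

lemma tail_neq_head: "dc_network net \<Longrightarrow> tail (grid net) e \<noteq> head (grid net) e"
  by (auto simp: dc_network_def loopfree_digraph_def loopfree_digraph_axioms_def)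

lemma sum_C_mat:
  assumes "dc_network net"
  shows "(\<Sum>v\<in>U. C_mat net $ v $ e * x v) =
    of_bool (tail (grid net) e \<in> U) * x (tail (grid net) e) - of_bool (head (grid net) e \<in> U) * x (head (grid net) e)"
proof -
  have "C_mat net $ v $ e * x v = (if v = tail (grid net) e then x v else 0) - (if v = head (grid net) e then x v else 0)" for v
    using tail_neq_head[OF assms] by (auto simp: C_mat_def)
  then show ?thesis by (simp add: sum_subtractf)
qed

lemma branch_flow_nth:
  assumes "dc_network net"
  shows "branch_flow net \<theta> $ e = suscept net e * (\<theta> $ tail (grid net) e - \<theta> $ head (grid net) e)"
proof -
  have "branch_flow net \<theta> = B_mat net *v (transpose (C_mat net) *v \<theta>)"
    by (simp only: branch_flow_def matrix_vector_mul_assoc)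
  then have "branch_flow net \<theta> $ e = suscept net e * (\<Sum>v\<in>UNIV. C_mat net $ v $ e * \<theta> $ v)"
    by (simp add: B_mat_def matrix_vector_mult_def transpose_def if_distrib[where f="\<lambda>x. x * _"] cong: if_cong)
  then show ?thesis using sum_C_mat[OF assms, where U=UNIV] by simp
qed

lemma laplacian_nth:
  "(laplacian net *v \<theta>) $ v = (\<Sum>e\<in>UNIV. C_mat net $ v $ e * branch_flow net \<theta> $ e)"
proof -
  have "laplacian net *v \<theta> = C_mat net *v branch_flow net \<theta>"
    by (simp only: laplacian_def branch_flow_def matrix_vector_mul_assoc matrix_mul_assoc)
  then show ?thesis by (simp add: matrix_vector_mult_def)
qed

text \<open>Discrete divergence theorem: flows on arcs with both ends in \<open>U\<close> cancel, so
  only the boundary arcs of \<open>U\<close> contribute.\<close>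

lemma laplacian_cut_sum:
  assumes "dc_network net"
  shows "(\<Sum>v\<in>U. (laplacian net *v \<theta>) $ v) = (\<Sum>e\<in>UNIV. branch_flow net \<theta> $ e *
    (of_bool (tail (grid net) e \<in> U) - of_bool (head (grid net) e \<in> U)))"
proof -
  have "(\<Sum>v\<in>U. (laplacian net *v \<theta>) $ v) = (\<Sum>e\<in>UNIV. branch_flow net \<theta> $ e * (\<Sum>v\<in>U. C_mat net $ v $ e))"
    by (simp add: laplacian_nth sum.swap[of _ UNIV U] sum_distrib_left mult.commute)
  then show ?thesis using sum_C_mat[OF assms, where x="\<lambda>_. 1"] by simp
qed

text \<open>Summation by parts turns the quadratic form into the Dirichlet energy of the
  angles.\<close>

lemma laplacian_quadratic_form:
  assumes "dc_network net"
  shows "\<theta> \<bullet> (laplacian net *v \<theta>) =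
    (\<Sum>e\<in>UNIV. suscept net e * (\<theta> $ tail (grid net) e - \<theta> $ head (grid net) e)\<^sup>2)"
proof -
  have "\<theta> \<bullet> (laplacian net *v \<theta>) = (\<Sum>v\<in>UNIV. \<Sum>e\<in>UNIV. branch_flow net \<theta> $ e * (C_mat net $ v $ e * \<theta> $ v))"
    by (simp add: laplacian_nth inner_vec_def sum_distrib_left mult_ac)
  also have "\<dots> = (\<Sum>e\<in>UNIV. branch_flow net \<theta> $ e * (\<Sum>v\<in>UNIV. C_mat net $ v $ e * \<theta> $ v))"
    by (subst sum.swap) (simp add: sum_distrib_left)
  finally show ?thesis
    unfolding sum_C_mat[OF assms] by (simp add: branch_flow_nth[OF assms] power2_eq_square mult_ac)
qed

text \<open>Zero energy with positive susceptances forces equal angles at the ends of each arc; no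
  arc then leaves a level set, and connectedness makes it everything.\<close>

lemma laplacian_kernel:
  assumes net: "dc_network net" and 0: "laplacian net *v \<theta> = 0"
  shows "\<theta> $ u = \<theta> $ v"
proof -
  have pos: "suscept net e > 0" for e using net by (simp add: dc_network_def)
  have "(\<Sum>e\<in>UNIV. suscept net e * (\<theta> $ tail (grid net) e - \<theta> $ head (grid net) e)\<^sup>2) = 0"
    using laplacian_quadratic_form[OF net, of \<theta>] 0 by simp
  then have eq: "\<theta> $ tail (grid net) e = \<theta> $ head (grid net) e" for e
    using pos by (subst (asm) sum_nonneg_eq_0_iff) (auto simp: less_imp_le less_imp_neq[symmetric])
  have "{w. \<theta> $ w = \<theta> $ v} = UNIV"
  proof (rule connected_closed_UNIV[of "grid net"])
    show "Digraph_Component.connected (grid net)" "verts (grid net) = UNIV"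
      using net by (simp_all add: dc_network_def)
    show "\<forall>e\<in>arcs (grid net). tail (grid net) e \<in> {w. \<theta> $ w = \<theta> $ v} \<longleftrightarrow> head (grid net) e \<in> {w. \<theta> $ w = \<theta> $ v}"
      by (simp add: eq)
    show "v \<in> {w. \<theta> $ w = \<theta> $ v}" by simp
  qed
  then show ?thesis by auto
qed

lemma laplacian_const: "dc_network net \<Longrightarrow> laplacian net *v vec c = 0"
  by (simp add: vec_eq_iff laplacian_nth branch_flow_nth)

lemma sum_laplacian: "dc_network net \<Longrightarrow> (\<Sum>v\<in>UNIV. (laplacian net *v \<theta>) $ v) = 0"
  by (subst laplacian_cut_sum) auto

text \<open>The Laplacian becomes invertible after adding the all-ones matrix, which vanishes on the
  vectors of sum zero.\<close>

lemma potential_exists: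
  fixes net :: "('g::finite, 'l::finite, 'e::finite) power_net"
  assumes net: "dc_network net"
  shows "\<exists>\<Theta>. linear \<Theta> \<and> (\<forall>y. (\<Sum>v\<in>UNIV. y $ v) = 0 \<longrightarrow> laplacian net *v \<Theta> y = y) \<and>
    (\<forall>y. \<Theta> y $ Inl (ref_gen net) = 0) \<and>
    (\<forall>\<theta>. \<theta> $ Inl (ref_gen net) = 0 \<longrightarrow> \<Theta> (laplacian net *v \<theta>) = \<theta>)"
proof -
  let ?s = "\<lambda>\<theta>::real^('g + 'l). \<Sum>v\<in>UNIV. \<theta> $ v"
  define A where "A \<theta> = laplacian net *v \<theta> + vec (?s \<theta>)" for \<theta>
  have lin: "linear A" unfolding A_def
    by (rule linearI) (auto simp: vec_eq_iff algebra_simps matrix_vector_right_distrib sum.distrib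
        sum_distrib_left matrix_vector_mult_scaleR)
  \<comment> \<open>The Laplacian part sums to zero, so \<open>A \<theta> = 0\<close> makes first
    the sum and then the Laplacian of \<open>\<theta>\<close> vanish.\<close>
  have sA: "?s (A \<theta>) = real CARD('g + 'l) * ?s \<theta>" for \<theta>
    using sum_laplacian[OF net, of \<theta>] by (simp add: A_def sum.distrib)
  have nz: "real CARD('g + 'l) \<noteq> 0" by (simp del: card_sum)
  have "inj A"
  proof (subst linear_injective_0[OF lin], safe)
    fix \<theta> assume A0: "A \<theta> = 0"
    then have s0: "?s \<theta> = 0" using sA[of \<theta>] nz by (auto simp del: card_sum)
    then have "laplacian net *v \<theta> = 0" using A0 by (simp add: A_def vec_eq_iff)
    then obtain c where c: "\<And>v. \<theta> $ v = c" using laplacian_kernel[OF net] by blast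
    then have "?s \<theta> = real CARD('g + 'l) * c" by (simp del: card_sum)
    then show "\<theta> = 0" using s0 nz c by (simp add: vec_eq_iff del: card_sum)
  qed
  then obtain T where T: "linear T" "\<And>x. T (A x) = x" "\<And>x. A (T x) = x"
    using linear_injective_isomorphism[OF lin] by metis
  let ?r = "Inl (ref_gen net) :: 'g + 'l"
  \<comment> \<open>A constant shift does not change the Laplacian, so it can be used to put the
    reference angle to 0.\<close>
  define \<Theta> where "\<Theta> y = T y - vec (T y $ ?r)" for y
  have L\<Theta>: "laplacian net *v \<Theta> y = laplacian net *v T y" for y
    by (simp add: \<Theta>_def matrix_vector_mult_diff_distrib laplacian_const[OF net])
  show ?thesis
  proof (intro exI[of _ \<Theta>] conjI allI impI)
    show "linear \<Theta>" unfolding \<Theta>_def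
      by (rule linearI) (simp_all add: vec_eq_iff linear_add[OF T(1)] linear_scale[OF T(1)] algebra_simps)
    show "\<Theta> y $ ?r = 0" for y by (simp add: \<Theta>_def)
    show L: "laplacian net *v \<Theta> y = y" if "?s y = 0" for y
    proof -
      have "?s (T y) = 0" using sA[of "T y"] that nz T(3) by (auto simp del: card_sum)
      then show ?thesis using T(3)[of y] L\<Theta>[of y] by (simp add: A_def vec_eq_iff)
    qed
    show "\<Theta> (laplacian net *v \<theta>) = \<theta>" if "\<theta> $ ?r = 0" for \<theta>
    proof -
      have "laplacian net *v (\<Theta> (laplacian net *v \<theta>) - \<theta>) = 0"
        using L[OF sum_laplacian[OF net]] by (simp add: matrix_vector_mult_diff_distrib)
      from laplacian_kernel[OF net this, of _ ?r] that show ?thesis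
        by (simp add: vec_eq_iff \<Theta>_def)
    qed
  qed
qed

text \<open>On balanced injections this is the unique normalised angle vector. On unbalanced ones it
  is some linear extension, which gives linearity without side conditions.\<close>

definition bus_angles ::
  "('g::finite, 'l::finite, 'e::finite) power_net \<Rightarrow> real^('g + 'l) \<Rightarrow> real^('g + 'l)" where
  "bus_angles net = (SOME \<Theta>. linear \<Theta> \<and> (\<forall>y. (\<Sum>v\<in>UNIV. y $ v) = 0 \<longrightarrow> laplacian net *v \<Theta> y = y) \<and>
    (\<forall>y. \<Theta> y $ Inl (ref_gen net) = 0) \<and>
    (\<forall>\<theta>. \<theta> $ Inl (ref_gen net) = 0 \<longrightarrow> \<Theta> (laplacian net *v \<theta>) = \<theta>))"

lemma
  assumes "dc_network net"
  shows linear_bus_angles: "linear (bus_angles net)"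
    and laplacian_bus_angles: "(\<Sum>v\<in>UNIV. y $ v) = 0 \<Longrightarrow> laplacian net *v bus_angles net y = y"
    and bus_angles_ref: "bus_angles net y $ Inl (ref_gen net) = 0"
    and bus_angles_laplacian: "\<theta> $ Inl (ref_gen net) = 0 \<Longrightarrow> bus_angles net (laplacian net *v \<theta>) = \<theta>"
  using someI_ex[OF potential_exists[OF assms]] unfolding bus_angles_def by blast+

lemma sum_injection: "(\<Sum>v\<in>UNIV. injection sg sl $ v) = (\<Sum>i\<in>UNIV. sg $ i) - (\<Sum>j\<in>UNIV. sl $ j)"
  by (simp add: UNIV_Plus_UNIV[symmetric] sum.Plus injection_def sum_negf del: UNIV_Plus_UNIV)

lemma injection_combine:
  "injection (a *\<^sub>R sg + b *\<^sub>R sg') (a *\<^sub>R sl + b *\<^sub>R sl') = a *\<^sub>R injection sg sl + b *\<^sub>R injection sg' sl'"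
  by (auto simp: vec_eq_iff injection_def algebra_simps split: sum.split)

lemma linear_branch_flow: "linear (branch_flow net)"
  unfolding branch_flow_def by (rule matrix_vector_mul_linear)

subsection \<open>Monotonicity for a fixed set of binding bridges\<close>

text \<open>The flow pattern on bridges determines the net injection of every component left after
  removing them; when the binding constraints determine the generation, each component contains
  at most one free generator, since otherwise power could be shifted between two of them.\<close>

lemma generation_nonneg_of_bridges:
  fixes net :: "('g::finite, 'l::finite, 'e::finite) power_net"
  assumes net: "dc_network net" and SB: "SB \<subseteq> bridges net"
    and rigid: "\<And>dg d\<theta>. laplacian net *v d\<theta> = injection dg 0 \<Longrightarrow> \<forall>i\<in>SG. dg $ i = 0 \<Longrightarrow>
      \<forall>e\<in>SB. branch_flow net d\<theta> $ e = 0 \<Longrightarrow> dg = 0"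
    and bal: "laplacian net *v \<theta> = injection sg sl"
    and SG0: "\<forall>i\<in>SG. sg $ i = 0" and SB0: "\<forall>e\<in>SB. branch_flow net \<theta> $ e = 0" and sl: "0 \<le> sl"
  shows "0 \<le> sg"
proof (rule ccontr)
  assume "\<not> 0 \<le> sg"
  then obtain g where g: "sg $ g < 0" by (auto simp: less_eq_vec_def not_le)
  let ?t = "tail (grid net)" and ?h = "head (grid net)"
  have "\<forall>e\<in>SB. \<exists>U. \<forall>e'. (?t e' \<in> U) \<noteq> (?h e' \<in> U) \<longleftrightarrow> e' = e"
    using bridge_cut[OF net] SB by (metis subsetD)
  then obtain U where U: "\<And>e e'. e \<in> SB \<Longrightarrow> (?t e' \<in> U e) \<noteq> (?h e' \<in> U e) \<longleftrightarrow> e' = e"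
    by (metis (full_types))
  \<comment> \<open>The buses on the same side as \<open>g\<close> of every binding bridge: the
    component of \<open>g\<close> once these bridges are removed.\<close>
  define K where "K = {v. \<forall>e\<in>SB. v \<in> U e \<longleftrightarrow> Inl g \<in> U e}"
  \<comment> \<open>An arc that leaves \<open>K\<close> crosses some chosen cut, hence is a binding
    bridge, and those carry no flow. So \<open>K\<close> is balanced on its own.\<close>
  have "branch_flow net \<theta> $ e * (of_bool (?t e \<in> K) - of_bool (?h e \<in> K)) = 0" for e
  proof (cases "?t e \<in> K \<longleftrightarrow> ?h e \<in> K")
    case False
    then obtain e' where "e' \<in> SB" "(?t e \<in> U e') \<noteq> (?h e \<in> U e')" by (auto simp: K_def)
    then show ?thesis using U SB0 by auto
  qed simp
  then have "(\<Sum>v\<in>K. injection sg sl $ v) = 0"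
    using laplacian_cut_sum[OF net, of \<theta> K] bal by (simp only: sum.neutral_const)
  moreover have "injection sg sl $ v \<le> 0" if "v \<in> K" "v \<noteq> Inl g" for v
  proof (cases v)
    case (Inr j)
    then show ?thesis using sl by (simp add: injection_def less_eq_vec_def)
  next
    case (Inl i)
    have "i \<in> SG"
    proof (rule ccontr)
      assume "i \<notin> SG"
      \<comment> \<open>Shift one unit of generation from \<open>i\<close> to \<open>g\<close>. Both
        are free: \<open>g\<close> is not in \<open>SG\<close> because its entry is
        negative.\<close>
      let ?d = "axis g 1 - axis i 1 :: real^'g"
      let ?y = "injection ?d (0 :: real^'l)"
      have "(\<Sum>v\<in>UNIV. ?y $ v) = 0" by (simp add: sum_injection axis_def sum_subtractf)
      then obtain d\<theta> where d\<theta>: "laplacian net *v d\<theta> = ?y"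
        using laplacian_bus_angles[OF net] by blast
      have "branch_flow net d\<theta> $ e = 0" if e: "e \<in> SB" for e
      proof -
        \<comment> \<open>\<open>U e\<close> contains both or neither of \<open>g\<close> and
          \<open>i\<close>, so its net injection is 0; up to sign this is the flow on
          \<open>e\<close>, the only arc crossing \<open>U e\<close>.\<close>
        have "(\<Sum>v\<in>U e. ?y $ v) = (\<Sum>v\<in>U e. if v = Inl g then 1 else 0) - (\<Sum>v\<in>U e. if v = Inl i then 1 else 0)"
          unfolding sum_subtractf[symmetric]
          by (intro sum.cong) (auto simp: injection_def axis_def split: sum.split)
        also have "\<dots> = 0" using e \<open>v \<in> K\<close> Inl by (auto simp: K_def)
        finally have "0 = (\<Sum>e'\<in>UNIV. branch_flow net d\<theta> $ e' * (of_bool (?t e' \<in> U e) - of_bool (?h e' \<in> U e)))"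
          using laplacian_cut_sum[OF net, of d\<theta> "U e"] d\<theta> by simp
        also have "\<dots> = (\<Sum>e'\<in>UNIV. if e' = e then branch_flow net d\<theta> $ e * (of_bool (?t e \<in> U e) - of_bool (?h e \<in> U e)) else 0)"
          using U[OF e] by (intro sum.cong) auto
        finally show ?thesis using U[OF e, of e] by auto
      qed
      moreover have "\<forall>k\<in>SG. ?d $ k = 0" using g SG0 \<open>i \<notin> SG\<close> by (auto simp: axis_def)
      ultimately have "?d = 0" using rigid[OF d\<theta>] by blast
      then show False using that(2) Inl by (metis axis_eq_axis eq_iff_diff_eq_0 zero_neq_one)
    qed
    then show ?thesis using SG0 Inl by (simp add: injection_def)
  qed
  \<comment> \<open>The injections over \<open>K\<close> sum to 0, yet the one at \<open>g\<close>
    is negative and no other is positive.\<close>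
  then have "(\<Sum>v\<in>K - {Inl g}. injection sg sl $ v) \<le> 0" by (intro sum_nonpos) auto
  moreover have "Inl g \<in> K" by (simp add: K_def)
  ultimately show False using g
    by (simp add: sum.remove[of K "Inl g"] injection_def)
qed

subsection \<open>Feasible dispatches\<close>

definition line_flow ::
  "('g::finite, 'l::finite, 'e::finite) power_net \<Rightarrow> real^'g \<Rightarrow> real^'l \<Rightarrow> real^'e" where
  "line_flow net sg sl = branch_flow net (bus_angles net (injection sg sl))"

lemma line_flow_combine:
  assumes "dc_network net"
  shows "line_flow net (a *\<^sub>R sg + b *\<^sub>R sg') (a *\<^sub>R sl + b *\<^sub>R sl') =
    a *\<^sub>R line_flow net sg sl + b *\<^sub>R line_flow net sg' sl'"
  using linear_bus_angles[OF assms] linear_branch_flow[of net]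
  by (simp add: line_flow_def injection_combine linear_add linear_scale)

lemma line_flow_diff:
  assumes "dc_network net"
  shows "line_flow net (sg - sg') (sl - sl') = line_flow net sg sl - line_flow net sg' sl'"
  using line_flow_combine[OF assms, of 1 sg "-1" sg' sl sl'] by simp

lemma tendsto_line_flow:
  assumes "dc_network net" "(G \<longlongrightarrow> sg) F" "(S \<longlongrightarrow> sl) F"
  shows "((\<lambda>x. line_flow net (G x) (S x)) \<longlongrightarrow> line_flow net sg sl) F"
proof -
  have "linear (\<lambda>p. line_flow net (fst p) (snd p))"
    using line_flow_combine[OF assms(1), of 1 _ 1] line_flow_combine[OF assms(1), of _ _ 0]
    by (intro linearI) auto
  then have "bounded_linear (\<lambda>p. line_flow net (fst p) (snd p))"
    by (simp add: linear_conv_bounded_linear)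
  from bounded_linear.tendsto[OF this tendsto_Pair[OF assms(2,3)]] show ?thesis by simp
qed

definition dispatch ::
  "('g::finite, 'l::finite, 'e::finite) power_net \<Rightarrow> ('g, 'e) limits \<Rightarrow> real^'l \<Rightarrow> real^'g \<Rightarrow> bool" where
  "dispatch net \<xi> sl sg \<longleftrightarrow> (\<Sum>i\<in>UNIV. sg $ i) = (\<Sum>j\<in>UNIV. sl $ j) \<and>
     sg_min \<xi> \<le> sg \<and> sg \<le> sg_max \<xi> \<and> p_min \<xi> \<le> line_flow net sg sl \<and> line_flow net sg sl \<le> p_max \<xi>"

text \<open>Images of the Laplacian sum to zero, and a balanced injection has exactly one angle
  vector vanishing at the reference bus. The angles therefore carry no freedom of their own.\<close>

lemma opf_feasible_dispatch:
  assumes "dc_network net"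
  shows "opf_feasible net \<xi> sl (sg, \<theta>) \<longleftrightarrow> dispatch net \<xi> sl sg \<and> \<theta> = bus_angles net (injection sg sl)"
proof
  assume fe: "opf_feasible net \<xi> sl (sg, \<theta>)"
  then have "\<theta> = bus_angles net (injection sg sl)"
    using bus_angles_laplacian[OF assms, of \<theta>] by (simp add: opf_feasible_def)
  moreover have "(\<Sum>v\<in>UNIV. injection sg sl $ v) = 0"
    using fe sum_laplacian[OF assms, of \<theta>] by (simp add: opf_feasible_def)
  ultimately show "dispatch net \<xi> sl sg \<and> \<theta> = bus_angles net (injection sg sl)"
    using fe by (simp add: opf_feasible_def dispatch_def line_flow_def sum_injection)
next
  assume "dispatch net \<xi> sl sg \<and> \<theta> = bus_angles net (injection sg sl)"
  then show "opf_feasible net \<xi> sl (sg, \<theta>)"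
    using laplacian_bus_angles[OF assms, of "injection sg sl"] bus_angles_ref[OF assms]
    by (simp add: opf_feasible_def dispatch_def line_flow_def sum_injection)
qed

lemma dispatch_convex:
  assumes net: "dc_network net" and d: "dispatch net \<xi> sl sg" "dispatch net \<xi> sl' sg'"
    and ab: "0 \<le> a" "0 \<le> b" "a + b = 1"
  shows "dispatch net \<xi> (a *\<^sub>R sl + b *\<^sub>R sl') (a *\<^sub>R sg + b *\<^sub>R sg')"
proof -
  have "m \<le> a * x + b * y" if "m \<le> x" "m \<le> y" for m x y :: real
    using convex_bound_le[of "-x" "-m" "-y" a b] that ab by simp
  moreover have "a * x + b * y \<le> m" if "x \<le> m" "y \<le> m" for m x y :: real
    using convex_bound_le[of x m y a b] that ab by simp
  ultimately show ?thesis
    using d unfolding dispatch_def line_flow_combine[OF net]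
    by (simp add: less_eq_vec_def sum.distrib sum_distrib_left[symmetric])
qed

lemma dispatch_closed:
  assumes net: "dc_network net" and d: "\<And>n. dispatch net \<xi> (S n) (G n)"
    and lim: "S \<longlonglongrightarrow> sl" "G \<longlonglongrightarrow> sg"
  shows "dispatch net \<xi> sl sg"
proof -
  have flow: "(\<lambda>n. line_flow net (G n) (S n) $ e) \<longlonglongrightarrow> line_flow net sg sl $ e" for e
    by (intro tendsto_vec_nth tendsto_line_flow net lim)
  have gen: "(\<lambda>n. G n $ i) \<longlonglongrightarrow> sg $ i" for i by (intro tendsto_vec_nth lim)
  have "(\<lambda>n. \<Sum>i\<in>UNIV. G n $ i) \<longlonglongrightarrow> (\<Sum>i\<in>UNIV. sg $ i)"
    "(\<lambda>n. \<Sum>j\<in>UNIV. S n $ j) \<longlonglongrightarrow> (\<Sum>j\<in>UNIV. sl $ j)"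
    by (intro tendsto_sum tendsto_vec_nth lim)+
  moreover have "(\<lambda>n. \<Sum>i\<in>UNIV. G n $ i) = (\<lambda>n. \<Sum>j\<in>UNIV. S n $ j)"
    using d by (auto simp: dispatch_def)
  ultimately have "(\<Sum>i\<in>UNIV. sg $ i) = (\<Sum>j\<in>UNIV. sl $ j)"
    using LIMSEQ_unique by metis
  then show ?thesis
    using d unfolding dispatch_def less_eq_vec_def
    by (auto intro!: LIMSEQ_le_const[OF flow] LIMSEQ_le_const2[OF flow] LIMSEQ_le_const[OF gen] LIMSEQ_le_const2[OF gen])
qed

text \<open>Slack inequalities survive small changes by continuity, so only the balance and the
  binding constraints have to be preserved. The general filter covers both a line of generation
  changes and a neighborhood of loads.\<close>

lemma dispatch_perturb:
  fixes F :: "'x filter"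
  assumes net: "dc_network net" and d: "dispatch net \<xi> sl sg"
    and lim: "(S \<longlongrightarrow> sl) F" "(G \<longlongrightarrow> sg) F"
    and bal: "\<forall>\<^sub>F x in F. (\<Sum>i\<in>UNIV. G x $ i) = (\<Sum>j\<in>UNIV. S x $ j)"
    and gen: "\<And>i. sg $ i \<in> {sg_min \<xi> $ i, sg_max \<xi> $ i} \<Longrightarrow> \<forall>\<^sub>F x in F. G x $ i = sg $ i"
    and flow: "\<And>e. line_flow net sg sl $ e \<in> {p_min \<xi> $ e, p_max \<xi> $ e} \<Longrightarrow>
      \<forall>\<^sub>F x in F. line_flow net (G x) (S x) $ e = line_flow net sg sl $ e"
  shows "\<forall>\<^sub>F x in F. dispatch net \<xi> (S x) (G x)"
proof -
  have between: "\<forall>\<^sub>F x in F. l \<le> y x \<and> y x \<le> u"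
    if "(y \<longlongrightarrow> c) F" "l \<le> c" "c \<le> u" "c \<in> {l, u} \<Longrightarrow> \<forall>\<^sub>F x in F. y x = c"
    for y :: "'x \<Rightarrow> real" and l c u
  proof (cases "c \<in> {l, u}")
    case True
    with that(2-4) show ?thesis by (auto elim: eventually_mono)
  next
    case False
    then have "l < c" "c < u" using that by auto
    then have "\<forall>\<^sub>F x in F. l < y x" "\<forall>\<^sub>F x in F. y x < u"
      using order_tendstoD[OF that(1)] by auto
    then show ?thesis by eventually_elim simp
  qed
  have "\<forall>\<^sub>F x in F. \<forall>i. sg_min \<xi> $ i \<le> G x $ i \<and> G x $ i \<le> sg_max \<xi> $ i"
    using d gen by (intro eventually_all_finite between[OF tendsto_vec_nth[OF lim(2)]]) (auto simp: dispatch_def less_eq_vec_def)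
  moreover have "\<forall>\<^sub>F x in F. \<forall>e. p_min \<xi> $ e \<le> line_flow net (G x) (S x) $ e \<and> line_flow net (G x) (S x) $ e \<le> p_max \<xi> $ e"
    using d flow by (intro eventually_all_finite between[OF tendsto_vec_nth[OF tendsto_line_flow[OF net lim(2,1)]]])
      (auto simp: dispatch_def less_eq_vec_def)
  ultimately show ?thesis using bal
    by eventually_elim (auto simp: dispatch_def less_eq_vec_def)
qed

subsection \<open>Continuous functions with finitely many monotone patches\<close>

text \<open>The patches are arbitrary sets rather than intervals, so the domain cannot be cut along
  them; the argument runs over the levels of \<open>h\<close> instead.\<close>

lemma continuous_finite_patch_le:
  fixes h :: "real \<Rightarrow> real" and k :: "real \<Rightarrow> 'c::finite"
  assumes cont: "continuous_on {a..b} h" and "a \<le> b"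
    and patch: "\<And>x y. a \<le> x \<Longrightarrow> x \<le> y \<Longrightarrow> y \<le> b \<Longrightarrow> k x = k y \<Longrightarrow> h x \<le> h y"
  shows "h a \<le> h b"
proof (rule ccontr)
  assume "\<not> h a \<le> h b"
  then have less: "h b < h a" by simp
  \<comment> \<open>The last crossing of a level moves left as the level rises, so two levels whose last
    crossings share a patch contradict monotonicity on that patch.\<close>
  have "\<forall>y\<in>{h b<..<h a}. \<exists>x\<in>{a..b}. h x = y \<and> (\<forall>z\<in>{a..b}. y \<le> h z \<longrightarrow> z \<le> x)"
  proof
    fix y assume y: "y \<in> {h b<..<h a}"
    let ?S = "{z \<in> {a..b}. y \<le> h z}"
    have "closed ?S"
      by (rule continuous_on_closed_Collect_le) (use cont in auto)
    then have "compact ?S"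
      by (metis (no_types, lifting) Int_absorb1 compact_Icc compact_Int_closed mem_Collect_eq subsetI)
    moreover have "a \<in> ?S" using y \<open>a \<le> b\<close> by simp
    ultimately obtain x where x: "x \<in> ?S" "\<forall>z\<in>?S. z \<le> x"
      using compact_attains_sup[of ?S] by blast
    \<comment> \<open>The level \<open>y\<close> is attained at or beyond the last point
      \<open>x\<close> with \<open>y \<le> h x\<close>; maximality puts it at \<open>x\<close>
      itself.\<close>
    have "continuous_on {x..b} h" using cont x(1) by (auto intro: continuous_on_subset)
    then obtain x' where x': "x \<le> x'" "x' \<le> b" "h x' = y"
      using IVT2'[of h b y x] x(1) y by auto
    moreover from this have "x' \<in> ?S" using x(1) by auto
    ultimately have "x' = x" using x(2) by force
    with x x'(3) show "\<exists>x\<in>{a..b}. h x = y \<and> (\<forall>z\<in>{a..b}. y \<le> h z \<longrightarrow> z \<le> x)"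
      by auto
  qed
  then obtain X where X: "\<And>y. y \<in> {h b<..<h a} \<Longrightarrow> X y \<in> {a..b} \<and> h (X y) = y \<and>
      (\<forall>z\<in>{a..b}. y \<le> h z \<longrightarrow> z \<le> X y)" by metis
  \<comment> \<open>Pigeonhole: infinitely many levels against finitely many patches.\<close>
  have "infinite {h b<..<h a}" using less by (rule infinite_Ioo)
  then have "\<not> inj_on (\<lambda>y. k (X y)) {h b<..<h a}"
    using finite_imageD[of "\<lambda>y. k (X y)" "{h b<..<h a}"] finite by blast
  then obtain y y' where yy: "y \<in> {h b<..<h a}" "y' \<in> {h b<..<h a}" "k (X y) = k (X y')" "y < y'"
    unfolding inj_on_def by (metis linorder_neqE_linordered_idom)
  have "X y' \<le> X y" using X[OF yy(1)] X[OF yy(2)] yy(4) by auto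
  then have "h (X y') \<le> h (X y)" using X[OF yy(1)] X[OF yy(2)] yy(3) by (intro patch) auto
  then show False using X[OF yy(1)] X[OF yy(2)] yy(4) by simp
qed

text \<open>A subsequence staying away from \<open>a\<close> would itself have a convergent
  subsequence. This turns uniqueness of the optimum into convergence.\<close>

lemma compact_unique_limit_tendsto:
  fixes x :: "nat \<Rightarrow> 'a::metric_space"
  assumes "compact K" "\<And>n. x n \<in> K"
    and lim: "\<And>r l. strict_mono r \<Longrightarrow> (x \<circ> r) \<longlonglongrightarrow> l \<Longrightarrow> l = a"
  shows "x \<longlonglongrightarrow> a"
proof (rule ccontr)
  assume "\<not> x \<longlonglongrightarrow> a"
  then obtain e where e: "e > 0" "\<exists>\<^sub>\<infinity>n. \<not> dist (x n) a < e"
    unfolding tendsto_iff by (auto simp: not_eventually frequently_sequentially cofinite_eq_sequentially)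
  then have "infinite {n. \<not> dist (x n) a < e}" by (simp add: INFM_iff_infinite)
  then obtain r :: "nat \<Rightarrow> nat" where r: "strict_mono r" "\<And>n. \<not> dist (x (r n)) a < e"
    using infinite_enumerate by blast
  obtain l q where q: "strict_mono q" "((x \<circ> r) \<circ> q) \<longlonglongrightarrow> l"
    using seq_compactE[OF compact_imp_seq_compact[OF assms(1)], of "x \<circ> r"] assms(2)
    by (metis comp_apply)
  then have "l = a" using lim[of "r \<circ> q" l] r(1) by (simp add: strict_mono_o o_assoc)
  then have "\<forall>\<^sub>F n in sequentially. dist (x (r (q n))) a < e"
    using q(2) e(1) by (auto simp: tendsto_iff)
  then show False using r(2) by (auto simp: eventually_sequentially)
qed

subsection \<open>The optimal dispatch\<close>

locale solvable_opf =
  fixes net :: "('g::finite, 'l::finite, 'e::finite) power_net"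
    and \<xi> :: "('g, 'e) limits" and f :: "real^'g"
  assumes net: "dc_network net" and limits: "\<xi> \<in> Omega net" and cost: "f \<in> Omega_f net \<xi>"
begin

abbreviation "\<Omega> \<equiv> Omega_s net \<xi>"
abbreviation "gen \<equiv> OPF net \<xi> f"
abbreviation "flow \<equiv> opt_flow net \<xi> f"

lemma Omega_dispatch: "sl \<in> \<Omega> \<longleftrightarrow> vless 0 sl \<and> (\<exists>sg. dispatch net \<xi> sl sg)"
  by (auto simp: Omega_s_def opf_feasible_dispatch[OF net])

lemma opf_sol_optimal:
  assumes "sl \<in> \<Omega>"
  shows "opf_optimal net \<xi> f sl x \<longleftrightarrow> x = opf_sol net \<xi> f sl"
proof -
  have "\<exists>!x. opf_optimal net \<xi> f sl x" using cost assms by (simp add: Omega_f_def)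
  from theI'[OF this] this show ?thesis unfolding opf_sol_def by blast
qed

lemma
  assumes sl: "sl \<in> \<Omega>"
  shows gen_dispatch: "dispatch net \<xi> sl (gen sl)"
    and gen_le: "dispatch net \<xi> sl sg \<Longrightarrow> f \<bullet> gen sl \<le> f \<bullet> sg"
    and gen_eqI: "dispatch net \<xi> sl sg \<Longrightarrow> f \<bullet> sg \<le> f \<bullet> gen sl \<Longrightarrow> sg = gen sl"
    and flow_eq: "flow sl = line_flow net (gen sl) sl"
proof -
  obtain \<theta> where sol: "opf_sol net \<xi> f sl = (gen sl, \<theta>)"
    unfolding OPF_def by (metis prod.collapse)
  then have opt: "opf_optimal net \<xi> f sl (gen sl, \<theta>)" using opf_sol_optimal[OF sl] by simp
  then show "dispatch net \<xi> sl (gen sl)"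
    by (simp add: opf_optimal_def opf_feasible_dispatch[OF net])
  show "flow sl = line_flow net (gen sl) sl"
    using opt sol by (simp add: opf_optimal_def opf_feasible_dispatch[OF net] opt_flow_def line_flow_def)
  show le: "f \<bullet> gen sl \<le> f \<bullet> sg" if "dispatch net \<xi> sl sg" for sg
    using opt that by (force simp: opf_optimal_def opf_feasible_dispatch[OF net])
  show "sg = gen sl" if "dispatch net \<xi> sl sg" "f \<bullet> sg \<le> f \<bullet> gen sl"
  proof -
    have "opf_optimal net \<xi> f sl (sg, bus_angles net (injection sg sl))"
      using that le by (force simp: opf_optimal_def opf_feasible_dispatch[OF net])
    then show ?thesis using opf_sol_optimal[OF sl] sol by simp
  qed
qed

section \<open>Convexity in the loads and continuity of the optimum\<close>

lemma convex_Omega: "convex \<Omega>"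
proof (rule convexI)
  fix x y and u v :: real assume "x \<in> \<Omega>" "y \<in> \<Omega>" and uv: "0 \<le> u" "0 \<le> v" "u + v = 1"
  moreover have "0 < u * p + v * q" if "0 < p" "0 < q" for p q
    using convex_bound_lt[of "- p" 0 "- q" u v] that uv by simp
  ultimately have "vless 0 (u *\<^sub>R x + v *\<^sub>R y)"
    by (auto simp: Omega_dispatch vless_def)
  then show "u *\<^sub>R x + v *\<^sub>R y \<in> \<Omega>"
    using \<open>x \<in> \<Omega>\<close> \<open>y \<in> \<Omega>\<close> dispatch_convex[OF net _ _ uv] unfolding Omega_dispatch by blast
qed

text \<open>A mixture of the two optimal dispatches is feasible for the mixed loads.\<close>

lemma cost_convex:
  assumes "x \<in> \<Omega>" "y \<in> \<Omega>" "0 \<le> u" "0 \<le> v" "u + v = 1"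
  shows "f \<bullet> gen (u *\<^sub>R x + v *\<^sub>R y) \<le> u * (f \<bullet> gen x) + v * (f \<bullet> gen y)"
proof -
  have "f \<bullet> gen (u *\<^sub>R x + v *\<^sub>R y) \<le> f \<bullet> (u *\<^sub>R gen x + v *\<^sub>R gen y)"
    using assms convexD[OF convex_Omega] by (intro gen_le dispatch_convex net gen_dispatch)
  then show ?thesis by (simp add: inner_add_right)
qed

text \<open>A subsequential limit is feasible by closedness and, through the bounds
  \<open>u\<close>, costs no more than the optimum, so uniqueness identifies it. In the interior
  \<open>u\<close> is the optimal cost itself; on segments to boundary points it comes from
  convexity.\<close>

lemma gen_tendsto:
  assumes S: "\<And>n. S n \<in> \<Omega>" "S \<longlonglongrightarrow> sl" and sl: "sl \<in> \<Omega>"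
    and u: "\<And>n. f \<bullet> gen (S n) \<le> u n" "u \<longlonglongrightarrow> f \<bullet> gen sl"
  shows "(\<lambda>n. gen (S n)) \<longlonglongrightarrow> gen sl"
proof (rule compact_unique_limit_tendsto)
  show "gen (S n) \<in> cbox (sg_min \<xi>) (sg_max \<xi>)" for n
    using gen_dispatch[OF S(1)] by (simp add: dispatch_def mem_box_cart less_eq_vec_def)
  fix r l assume r: "strict_mono r" and l: "((\<lambda>n. gen (S n)) \<circ> r) \<longlonglongrightarrow> l"
  have "dispatch net \<xi> sl l"
    by (rule dispatch_closed[OF net _ LIMSEQ_subseq_LIMSEQ[OF S(2) r] l]) (simp add: gen_dispatch[OF S(1)])
  moreover have "f \<bullet> l \<le> f \<bullet> gen sl"
    using tendsto_inner[OF tendsto_const[of f] l] LIMSEQ_subseq_LIMSEQ[OF u(2) r]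
    by (rule LIMSEQ_le) (use u(1) in auto)
  ultimately show "l = gen sl" by (rule gen_eqI[OF sl])
qed (rule compact_cbox)

text \<open>A convex function is continuous on an open set, which gives continuity of the optimal
  cost; \<open>gen_tendsto\<close> lifts it to the optimum.\<close>

lemma continuous_on_gen: "continuous_on (interior \<Omega>) gen"
proof (rule continuous_on_sequentiallyI)
  fix S sl assume S: "\<forall>n. S n \<in> interior \<Omega>" "sl \<in> interior \<Omega>" "S \<longlonglongrightarrow> sl"
  have "convex_on (interior \<Omega>) (\<lambda>x. f \<bullet> gen x)"
    using cost_convex interior_subset[of \<Omega>] convex_interior[OF convex_Omega]
    by (auto simp: convex_on_def subset_iff)
  then have "continuous_on (interior \<Omega>) (\<lambda>x. f \<bullet> gen x)"
    by (rule convex_on_continuous[OF open_interior])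
  then have "(\<lambda>n. f \<bullet> gen (S n)) \<longlonglongrightarrow> f \<bullet> gen sl"
    using S by (auto simp: continuous_on_sequentially o_def)
  then show "(\<lambda>n. gen (S n)) \<longlonglongrightarrow> gen sl"
    using S interior_subset[of \<Omega>] by (intro gen_tendsto[where u = "\<lambda>n. f \<bullet> gen (S n)"]) auto
qed

lemma tendsto_gen: "sl \<in> interior \<Omega> \<Longrightarrow> (gen \<longlongrightarrow> gen sl) (nhds sl)"
  using continuous_on_gen open_interior
  by (simp add: continuous_on_eq_continuous_at continuous_at isCont_def tendsto_at_iff_tendsto_nhds)

lemma tendsto_flow:
  assumes "sl \<in> interior \<Omega>" shows "(flow \<longlongrightarrow> flow sl) (nhds sl)"
proof -
  have "((\<lambda>x. line_flow net (gen x) x) \<longlongrightarrow> line_flow net (gen sl) sl) (nhds sl)"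
    using assms by (intro tendsto_line_flow net tendsto_gen filterlim_ident)
  moreover have "\<forall>\<^sub>F x in nhds sl. line_flow net (gen x) x = flow x"
    using eventually_nhds_in_open[OF open_interior assms] interior_subset[of \<Omega>]
    by (auto elim!: eventually_mono simp: flow_eq)
  moreover have "line_flow net (gen sl) sl = flow sl"
    using assms interior_subset[of \<Omega>] by (auto simp: flow_eq)
  ultimately show ?thesis by (simp add: tendsto_cong)
qed

text \<open>A direction along which all binding constraints stay binding could be followed both ways,
  contradicting uniqueness of the optimum.\<close>

lemma binding_rigid:
  assumes sl: "sl \<in> \<Omega>" and bal: "(\<Sum>i\<in>UNIV. dg $ i) = 0"
    and SG: "\<forall>i\<in>S_G net \<xi> f sl. dg $ i = 0" and SB: "\<forall>e\<in>S_B net \<xi> f sl. line_flow net dg 0 $ e = 0"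
  shows "dg = 0"
proof -
  let ?G = "\<lambda>t. gen sl + t *\<^sub>R dg"
  have fl: "line_flow net (?G t) sl = line_flow net (gen sl) sl + t *\<^sub>R line_flow net dg 0" for t
    using line_flow_combine[OF net, of 1 "gen sl" t dg sl 0] by simp
  have "\<forall>\<^sub>F t in at 0. dispatch net \<xi> sl (?G t)"
  proof (rule dispatch_perturb[OF net gen_dispatch[OF sl]])
    show "(?G \<longlongrightarrow> gen sl) (at 0)" by (auto intro!: tendsto_eq_intros)
    show "\<forall>\<^sub>F t in at 0. (\<Sum>i\<in>UNIV. ?G t $ i) = (\<Sum>j\<in>UNIV. sl $ j)"
      using gen_dispatch[OF sl] bal by (simp add: dispatch_def sum.distrib sum_distrib_left[symmetric])
    show "\<forall>\<^sub>F t in at 0. ?G t $ i = gen sl $ i" if "gen sl $ i \<in> {sg_min \<xi> $ i, sg_max \<xi> $ i}" for i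
      using that SG by (auto simp: S_G_def)
    show "\<forall>\<^sub>F t in at 0. line_flow net (?G t) sl $ e = line_flow net (gen sl) sl $ e"
      if "line_flow net (gen sl) sl $ e \<in> {p_min \<xi> $ e, p_max \<xi> $ e}" for e
      using that SB by (auto simp: S_B_def flow_eq[OF sl] fl)
  qed simp
  then obtain d where d: "d > 0" "\<And>t. t \<noteq> 0 \<Longrightarrow> dist t 0 < d \<Longrightarrow> dispatch net \<xi> sl (?G t)"
    by (auto simp: eventually_at)
  define t where "t = d / 2"
  have t: "t > 0" "dispatch net \<xi> sl (?G t)" "dispatch net \<xi> sl (?G (- t))"
    using d(1) d(2)[of t] d(2)[of "- t"] by (simp_all add: t_def dist_real_def)
  \<comment> \<open>The dispatch at \<open>- t\<close> costs at least the optimum, so by linearity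
    the one at \<open>t\<close> costs at most that.\<close>
  have "f \<bullet> ?G t \<le> f \<bullet> gen sl"
    using gen_le[OF sl t(3)] by (simp add: inner_add_right inner_diff_right)
  from gen_eqI[OF sl t(2) this] t(1) show ?thesis by simp
qed

section \<open>Loads with N_G - 1 binding constraints\<close>

lemma limits_strict: "sg_min \<xi> $ i < sg_max \<xi> $ i" "p_min \<xi> $ e < p_max \<xi> $ e"
  using limits by (auto simp: Omega_def vless_def)

text \<open>Strict limits prevent a component from binding at both ends, so nothing is counted
  twice.\<close>

lemma num_binding_eq: "num_binding net \<xi> f sl = card (S_G net \<xi> f sl) + card (S_B net \<xi> f sl)"
proof -
  have "S_G net \<xi> f sl = {i. gen sl $ i = sg_min \<xi> $ i} \<union> {i. gen sl $ i = sg_max \<xi> $ i}"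
    "S_B net \<xi> f sl = {e. flow sl $ e = p_min \<xi> $ e} \<union> {e. flow sl $ e = p_max \<xi> $ e}"
    by (auto simp: S_G_def S_B_def)
  moreover have "{i. gen sl $ i = sg_min \<xi> $ i} \<inter> {i. gen sl $ i = sg_max \<xi> $ i} = {}"
    "{e. flow sl $ e = p_min \<xi> $ e} \<inter> {e. flow sl $ e = p_max \<xi> $ e} = {}"
    using less_imp_neq[OF limits_strict(1), symmetric] less_imp_neq[OF limits_strict(2), symmetric] by auto
  ultimately show ?thesis by (simp add: num_binding_def card_Un_disjoint)
qed

text \<open>The \<open>N\<^sub>G - 1\<close> binding constraints and the power balance form a square system which is
  injective, hence solvable for all perturbed loads.\<close>

lemma tilde_interior:
  assumes tl: "sl \<in> Omega_s_tilde net \<xi> f"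
  shows "sl \<in> interior \<Omega>"
proof -
  have sl: "sl \<in> \<Omega>" using tl by (simp add: Omega_s_tilde_def)
  let ?SG = "S_G net \<xi> f sl" and ?SB = "S_B net \<xi> f sl"
  \<comment> \<open>Labels of the equations: \<open>None\<close> is the power balance, the others
    are the binding generators and branches, N_G in total.\<close>
  define I where "I = insert None (Some ` (Inl ` ?SG \<union> Inr ` ?SB))"
  have "card (Inl ` ?SG \<union> Inr ` ?SB) = card ?SG + card ?SB"
    by (subst card_Un_disjoint) (auto simp: card_image)
  also have "\<dots> = CARD('g) - 1" using tl by (simp add: Omega_s_tilde_def num_binding_eq)
  finally have "card I = CARD('g)"
    unfolding I_def by (subst card_insert_disjoint) (auto simp: card_image)
  \<comment> \<open>Labelling the equations by generators makes the system an endomorphism of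
    \<open>real^'g\<close>.\<close>
  then obtain h :: "'g \<Rightarrow> ('g + 'e) option" where h: "bij_betw h UNIV I"
    using finite_same_card_bij[of "UNIV :: 'g set" I] by auto
  \<comment> \<open>\<open>c\<close> is the effect of a generation change on each constraint,
    \<open>r\<close> the value it must have to offset a load change.\<close>
  define c where "c k x = (case k of None \<Rightarrow> (\<Sum>i\<in>UNIV. x $ i) | Some (Inl i) \<Rightarrow> x $ i
    | Some (Inr e) \<Rightarrow> line_flow net x 0 $ e)" for k :: "('g + 'e) option" and x :: "real^'g"
  define r where "r k y = (case k of None \<Rightarrow> (\<Sum>j\<in>UNIV. y $ j) | Some (Inl i) \<Rightarrow> 0
    | Some (Inr e) \<Rightarrow> - line_flow net 0 y $ e)" for k :: "('g + 'e) option" and y :: "real^'l"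
  define \<Phi> where "\<Phi> x = (\<chi> i. c (h i) x)" for x
  define R where "R y = (\<chi> i. r (h i) y)" for y
  have lf: "line_flow net (x + y) 0 = line_flow net x 0 + line_flow net y 0"
    "line_flow net (a *\<^sub>R x) 0 = a *\<^sub>R line_flow net x 0" for x y a
    using line_flow_combine[OF net, of 1 x 1 y 0 0] line_flow_combine[OF net, of a x 0 0 0 0] by simp_all
  have lin: "linear \<Phi>"
    by (rule linearI) (auto simp: \<Phi>_def c_def vec_eq_iff lf sum.distrib sum_distrib_left split: option.split sum.split)
  have sys: "\<forall>k\<in>I. c k x = b k" if "\<Phi> x = (\<chi> i. b (h i))" for x b
    using that h unfolding \<Phi>_def by (auto simp: bij_betw_def vec_eq_iff)
  have "inj \<Phi>"
  proof (subst linear_injective_0[OF lin], safe)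
    fix x assume "\<Phi> x = 0"
    then have "\<forall>k\<in>I. c k x = 0" using sys[of x "\<lambda>_. 0"] by (simp add: vec_eq_iff)
    then have "c None x = 0" "\<forall>i\<in>?SG. c (Some (Inl i)) x = 0" "\<forall>e\<in>?SB. c (Some (Inr e)) x = 0"
      unfolding I_def by blast+
    then show "x = 0" by (intro binding_rigid[OF sl]) (simp_all add: c_def)
  qed
  then obtain T where T: "linear T" "\<And>x. \<Phi> (T x) = x"
    using linear_injective_isomorphism[OF lin] by metis
  \<comment> \<open>The generation adjusted to loads \<open>y\<close> so that every binding
    constraint keeps its value.\<close>
  define G where "G y = gen sl + T (R (y - sl))" for y
  have cG: "c k (T (R y)) = r k y" if "k \<in> I" for k y
    using sys[of "T (R y)" "\<lambda>k. r k y"] T(2) that by (simp add: R_def)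
  have RL: "(R \<longlongrightarrow> 0) (nhds 0)"
  proof -
    have "((\<lambda>y. r k y) \<longlongrightarrow> 0) (nhds 0)" for k
    proof -
      have "((\<lambda>y. line_flow net 0 y) \<longlongrightarrow> line_flow net 0 0) (nhds 0)"
        by (intro tendsto_line_flow net tendsto_const filterlim_ident)
      moreover have "line_flow net 0 0 = 0" using line_flow_combine[OF net, of 0 0 0 0 0 0] by simp
      ultimately have "((\<lambda>y. - (line_flow net 0 y $ e)) \<longlongrightarrow> 0) (nhds 0)" for e
        by (auto intro!: tendsto_eq_intros)
      moreover have "((\<lambda>y::real^'l. \<Sum>j\<in>UNIV. y $ j) \<longlongrightarrow> 0) (nhds 0)"
        by (auto intro!: tendsto_eq_intros filterlim_ident)
      moreover have "k = None \<or> (\<exists>i. k = Some (Inl i)) \<or> (\<exists>e. k = Some (Inr e))"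
        by (metis option.exhaust sumE)
      ultimately show ?thesis by (elim disjE exE) (simp_all add: r_def)
    qed
    then show ?thesis unfolding R_def by (intro vec_tendstoI) auto
  qed
  have "bounded_linear T" using T(1) by (simp add: linear_conv_bounded_linear)
  moreover have "((\<lambda>y. R (y - sl)) \<longlongrightarrow> 0) (nhds sl)"
    by (rule filterlim_compose[OF RL]) (auto intro!: tendsto_eq_intros filterlim_ident)
  ultimately have "((\<lambda>y. T (R (y - sl))) \<longlongrightarrow> T 0) (nhds sl)" by (rule bounded_linear.tendsto)
  from tendsto_add[OF tendsto_const this, of "gen sl"]
  have limG: "(G \<longlongrightarrow> gen sl) (nhds sl)" using linear_0[OF T(1)] by (simp add: G_def[abs_def])
  have "\<forall>\<^sub>F y in nhds sl. dispatch net \<xi> y (G y)"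
  proof (rule dispatch_perturb[OF net gen_dispatch[OF sl] filterlim_ident limG])
    show "\<forall>\<^sub>F y in nhds sl. (\<Sum>i\<in>UNIV. G y $ i) = (\<Sum>j\<in>UNIV. y $ j)"
      using gen_dispatch[OF sl] cG[of None]
      by (simp add: I_def c_def r_def G_def dispatch_def sum.distrib sum_subtractf)
    show "\<forall>\<^sub>F y in nhds sl. G y $ i = gen sl $ i" if "gen sl $ i \<in> {sg_min \<xi> $ i, sg_max \<xi> $ i}" for i
      using cG[of "Some (Inl i)"] that by (simp add: I_def c_def r_def G_def S_G_def)
    show "\<forall>\<^sub>F y in nhds sl. line_flow net (G y) y $ e = line_flow net (gen sl) sl $ e"
      if "line_flow net (gen sl) sl $ e \<in> {p_min \<xi> $ e, p_max \<xi> $ e}" for e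
    proof (intro always_eventually allI)
      fix y
      have "line_flow net (T (R (y - sl))) 0 $ e + line_flow net 0 (y - sl) $ e = 0"
        using cG[of "Some (Inr e)"] that by (auto simp: I_def c_def r_def S_B_def flow_eq[OF sl])
      moreover have "line_flow net (G y) y - line_flow net (gen sl) sl =
          line_flow net (T (R (y - sl))) 0 + line_flow net 0 (y - sl)"
        using line_flow_diff[OF net, of "G y" "gen sl" y sl]
          line_flow_combine[OF net, of 1 "T (R (y - sl))" 1 0 0 "y - sl"]
        by (simp add: G_def)
      ultimately have "(line_flow net (G y) y - line_flow net (gen sl) sl) $ e = 0" by simp
      then show "line_flow net (G y) y $ e = line_flow net (gen sl) sl $ e" by simp
    qed
  qed
  moreover have "\<forall>\<^sub>F y in nhds sl. \<forall>j. 0 < y $ j"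
    using sl by (intro eventually_all_finite order_tendstoD(1)[OF tendsto_vec_nth[OF filterlim_ident]])
      (auto simp: Omega_dispatch vless_def)
  ultimately have "\<forall>\<^sub>F y in nhds sl. y \<in> \<Omega>"
    by eventually_elim (auto simp: Omega_dispatch vless_def)
  then show ?thesis by (auto simp: eventually_nhds interior_def)
qed

section \<open>Patches with common binding constraints\<close>

definition binding :: "real^'l \<Rightarrow> ('g set \<times> 'g set) \<times> ('e set \<times> 'e set)" where
  "binding sl = (({i. gen sl $ i = sg_min \<xi> $ i}, {i. gen sl $ i = sg_max \<xi> $ i}),
     ({e. flow sl $ e = p_min \<xi> $ e}, {e. flow sl $ e = p_max \<xi> $ e}))"

lemma S_B_mono: "binding s \<le> binding t \<Longrightarrow> S_B net \<xi> f s \<subseteq> S_B net \<xi> f t"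
  by (auto simp: binding_def less_eq_prod_def S_B_def)

text \<open>Slack constraints stay slack nearby, by continuity of generation and flow.\<close>

lemma binding_upper_semicontinuous:
  assumes "sl \<in> interior \<Omega>"
  shows "\<forall>\<^sub>F y in nhds sl. binding y \<le> binding sl"
proof -
  have ne: "\<forall>\<^sub>F y in nhds sl. v y = m \<longrightarrow> v sl = m" if "(v \<longlongrightarrow> v sl) (nhds sl)" for v :: "_ \<Rightarrow> real" and m
  proof (cases "v sl = m")
    case False
    from tendsto_imp_eventually_ne[OF that this] show ?thesis by eventually_elim simp
  qed simp
  have g: "\<forall>\<^sub>F y in nhds sl. \<forall>i. gen y $ i = m i \<longrightarrow> gen sl $ i = m i" for m
    by (intro eventually_all_finite ne tendsto_vec_nth tendsto_gen assms)
  have fl: "\<forall>\<^sub>F y in nhds sl. \<forall>e. flow y $ e = m e \<longrightarrow> flow sl $ e = m e" for m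
    by (intro eventually_all_finite ne tendsto_vec_nth tendsto_flow assms)
  from g[of "($) (sg_min \<xi>)"] g[of "($) (sg_max \<xi>)"] fl[of "($) (p_min \<xi>)"] fl[of "($) (p_max \<xi>)"]
  show ?thesis
    by eventually_elim (auto simp: binding_def less_eq_prod_def)
qed

text \<open>\<open>binding\<close> keeps lower and upper limits apart, so each constraint binding at
  \<open>t\<close> has the same value at \<open>a\<close> and \<open>b\<close>. The difference of
  the two optima thus vanishes on those constraints, and rigidity at \<open>t\<close> applies;
  \<open>a\<close> and \<open>b\<close> may have further binding constraints.\<close>

lemma gen_mono_of_binding:
  assumes "t \<in> \<Omega>" "a \<in> \<Omega>" "b \<in> \<Omega>" and SB: "S_B net \<xi> f t \<subseteq> bridges net"
    and le: "binding t \<le> binding a" "binding t \<le> binding b" and "a \<le> b"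
  shows "gen a \<le> gen b"
proof -
  have "0 \<le> gen b - gen a"
  proof (rule generation_nonneg_of_bridges[OF net SB])
    show "dg = 0" if lap: "laplacian net *v d\<theta> = injection dg 0"
      and SG: "\<forall>i\<in>S_G net \<xi> f t. dg $ i = 0" and fl: "\<forall>e\<in>S_B net \<xi> f t. branch_flow net d\<theta> $ e = 0" for dg d\<theta>
    proof -
      have bal: "(\<Sum>v\<in>UNIV. injection dg (0 :: real^'l) $ v) = 0"
        using lap sum_laplacian[OF net, of d\<theta>] by simp
      \<comment> \<open>The given angles are not normalised, but they differ from
        \<open>bus_angles\<close> by a constant, which no flow sees.\<close>
      have "laplacian net *v (d\<theta> - bus_angles net (injection dg 0)) = 0"
        using lap laplacian_bus_angles[OF net bal] by (simp add: matrix_vector_mult_diff_distrib)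
      note ker = laplacian_kernel[OF net this]
      have "branch_flow net (d\<theta> - bus_angles net (injection dg 0)) = 0"
        using ker by (simp add: vec_eq_iff branch_flow_nth[OF net])
      then have "line_flow net dg 0 = branch_flow net d\<theta>"
        unfolding linear_diff[OF linear_branch_flow] by (simp add: line_flow_def)
      then show ?thesis
        using binding_rigid[OF \<open>t \<in> \<Omega>\<close> _ SG] fl bal by (simp add: sum_injection)
    qed
    show "laplacian net *v bus_angles net (injection (gen b - gen a) (b - a)) = injection (gen b - gen a) (b - a)"
      using gen_dispatch[OF \<open>a \<in> \<Omega>\<close>] gen_dispatch[OF \<open>b \<in> \<Omega>\<close>]
      by (intro laplacian_bus_angles[OF net]) (simp add: sum_injection dispatch_def sum_subtractf)
    show "\<forall>i\<in>S_G net \<xi> f t. (gen b - gen a) $ i = 0"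
      using le by (auto simp: S_G_def binding_def less_eq_prod_def subset_iff)
    have "line_flow net (gen b - gen a) (b - a) = flow b - flow a"
      using line_flow_diff[OF net] flow_eq \<open>a \<in> \<Omega>\<close> \<open>b \<in> \<Omega>\<close> by simp
    then show "\<forall>e\<in>S_B net \<xi> f t. branch_flow net (bus_angles net (injection (gen b - gen a) (b - a))) $ e = 0"
      using le by (auto simp: S_B_def binding_def less_eq_prod_def subset_iff line_flow_def[symmetric])
    show "0 \<le> b - a" using \<open>a \<le> b\<close> by simp
  qed
  then show ?thesis by simp
qed

section \<open>Sign of the derivative and global monotonicity\<close>

lemma jacobian_nonneg:
  assumes sl: "sl \<in> interior \<Omega>" and SB: "S_B net \<xi> f sl \<subseteq> bridges net"
    and diff: "gen differentiable (at sl within \<Omega>)"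
  shows "0 \<le> dOPF net \<xi> f sl"
proof -
  define D where "D = dOPF net \<xi> f sl"
  have at: "at sl within \<Omega> = at sl" using sl by (rule at_within_interior)
  have D: "(gen has_derivative (\<lambda>h. D *v h)) (at sl)"
    using diff unfolding D_def dOPF_def at by (simp add: jacobian_works)
  have "0 \<le> D $ i $ j" for i j
  proof (rule ccontr)
    assume neg: "\<not> 0 \<le> D $ i $ j"
    let ?p = "\<lambda>h. sl + h *\<^sub>R axis j (1::real)"
    have p: "(?p \<longlongrightarrow> sl) (nhds 0)" by (auto intro!: tendsto_eq_intros filterlim_ident)
    have "(?p has_derivative (\<lambda>h. h *\<^sub>R axis j 1)) (at 0)" by (auto intro!: derivative_eq_intros)
    from has_derivative_compose[OF this, of gen "\<lambda>h. D *v h"] D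
    have "((\<lambda>h. gen (?p h) $ i) has_derivative (\<lambda>h. (D *v (h *\<^sub>R axis j 1)) $ i)) (at 0)"
      by (auto intro: bounded_linear.has_derivative[OF bounded_linear_vec_nth])
    moreover have "(D *v (h *\<^sub>R axis j 1)) $ i = D $ i $ j * h" for h
      by (simp add: matrix_vector_mult_scaleR matrix_vector_mul_component inner_axis)
    ultimately have "((\<lambda>h. gen (?p h) $ i) has_real_derivative D $ i $ j) (at 0)"
      by (simp add: has_field_derivative_def)
    from has_real_derivative_neg_dec_right[OF this] neg
    obtain d where d: "d > 0" "\<And>h. 0 < h \<Longrightarrow> h < d \<Longrightarrow> gen (?p h) $ i < gen sl $ i"
      by (auto simp: not_le)
    have "\<forall>\<^sub>F y in nhds sl. y \<in> \<Omega> \<and> binding y \<le> binding sl"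
      using binding_upper_semicontinuous[OF sl] eventually_nhds_in_open[OF open_interior sl] interior_subset[of \<Omega>]
      by (auto elim: eventually_elim2)
    with p have "\<forall>\<^sub>F h in nhds 0. ?p h \<in> \<Omega> \<and> binding (?p h) \<le> binding sl"
      by (auto simp: filterlim_iff)
    then obtain e where e: "e > 0" "\<And>h. dist h 0 < e \<Longrightarrow> ?p h \<in> \<Omega> \<and> binding (?p h) \<le> binding sl"
      by (auto simp: eventually_nhds_metric)
    define h where "h = min d e / 2"
    have h: "0 < h" "h < d" "h < e" using d(1) e(1) by (auto simp: h_def)
    have "gen sl \<le> gen (?p h)"
    \<comment> \<open>The stepped point itself is the reference \<open>t\<close>: its binding
      constraints are among those of \<open>sl\<close>, hence also bridges.\<close>
    proof (rule gen_mono_of_binding[of "?p h"])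
      show "S_B net \<xi> f (?p h) \<subseteq> bridges net"
        using S_B_mono e(2)[of h] h SB by (auto simp: dist_real_def)
      show "sl \<le> ?p h" using h(1) by (auto simp: less_eq_vec_def axis_def)
    qed (use e(2)[of h] h sl interior_subset[of \<Omega>] in \<open>auto simp: dist_real_def\<close>)
    then show False using d(2)[OF h(1,2)] by (auto simp: less_eq_vec_def not_less[symmetric])
  qed
  then show ?thesis by (simp add: less_eq_vec_def D_def)
qed

lemma monotone_interior:
  assumes dense: "\<Omega> \<subseteq> closure (Omega_s_tilde net \<xi> f)"
    and SB: "\<forall>t\<in>Omega_s_tilde net \<xi> f. S_B net \<xi> f t \<subseteq> bridges net"
    and a: "a \<in> interior \<Omega>" and b: "b \<in> interior \<Omega>" and "a \<le> b"
  shows "gen a \<le> gen b"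
proof -
  let ?p = "\<lambda>x::real. (1 - x) *\<^sub>R a + x *\<^sub>R b"
  have p: "?p x \<in> interior \<Omega>" if "0 \<le> x" "x \<le> 1" for x
    using convexD_alt[OF convex_interior[OF convex_Omega] a b] that by simp
  have pm: "?p x \<le> ?p y" if "x \<le> y" for x y
  proof -
    have "?p y $ j - ?p x $ j = (y - x) * (b $ j - a $ j)" for j by (simp add: algebra_simps)
    then have "0 \<le> ?p y $ j - ?p x $ j" for j using that \<open>a \<le> b\<close> by (simp add: less_eq_vec_def)
    then show ?thesis by (simp add: less_eq_vec_def)
  qed
  \<comment> \<open>Density puts a point of the dense set into the neighborhood where binding
    constraints can only be lost.\<close>
  have "\<exists>t\<in>Omega_s_tilde net \<xi> f. binding t \<le> binding (?p x)" if x: "0 \<le> x" "x \<le> 1" for x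
  proof -
    obtain U where U: "open U" "?p x \<in> U" "\<And>y. y \<in> U \<Longrightarrow> binding y \<le> binding (?p x)"
      using binding_upper_semicontinuous[OF p[OF x]] by (auto simp: eventually_nhds)
    have "?p x \<in> closure (Omega_s_tilde net \<xi> f)" using p[OF x] interior_subset[of \<Omega>] dense by blast
    with U show ?thesis by (metis closure_iff_nhds_not_empty disjoint_iff order_refl)
  qed
  then obtain t where t: "\<And>x. 0 \<le> x \<Longrightarrow> x \<le> 1 \<Longrightarrow> t x \<in> Omega_s_tilde net \<xi> f \<and> binding (t x) \<le> binding (?p x)"
    by metis
  have "gen (?p 0) $ i \<le> gen (?p 1) $ i" for i
  \<comment> \<open>The patch of \<open>x\<close> is the binding pattern of \<open>t x\<close>,
    which ranges over a finite type; when two patterns agree, \<open>t x\<close> serves as reference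
    for both points.\<close>
  proof (rule continuous_finite_patch_le[where a = 0 and b = 1 and h = "\<lambda>x. gen (?p x) $ i" and k = "\<lambda>x. binding (t x)"])
    have "continuous_on {0..1} (\<lambda>x. gen (?p x))"
      by (rule continuous_on_compose2[OF continuous_on_gen]) (auto intro!: continuous_intros p)
    then show "continuous_on {0..1} (\<lambda>x. gen (?p x) $ i)" by (intro continuous_intros)
    fix x y :: real assume xy: "0 \<le> x" "x \<le> y" "y \<le> 1" "binding (t x) = binding (t y)"
    have "gen (?p x) \<le> gen (?p y)"
    proof (rule gen_mono_of_binding[of "t x"])
      show "t x \<in> \<Omega>" "S_B net \<xi> f (t x) \<subseteq> bridges net"
        using t[of x] SB xy by (auto simp: Omega_s_tilde_def)
      show "?p x \<in> \<Omega>" "?p y \<in> \<Omega>" using p[of x] p[of y] xy interior_subset[of \<Omega>] by auto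
      show "binding (t x) \<le> binding (?p x)" "binding (t x) \<le> binding (?p y)" "?p x \<le> ?p y"
        using t[of x] t[of y] xy pm by auto
    qed
    then show "gen (?p x) $ i \<le> gen (?p y) $ i" by (simp add: less_eq_vec_def)
  qed simp
  then show ?thesis by (simp add: less_eq_vec_def)
qed

lemma gen_monotone:
  assumes dense: "\<Omega> \<subseteq> closure (Omega_s_tilde net \<xi> f)"
    and SB: "\<forall>t\<in>Omega_s_tilde net \<xi> f. S_B net \<xi> f t \<subseteq> bridges net"
    and a: "a \<in> \<Omega>" and b: "b \<in> \<Omega>" and "a \<le> b"
  shows "gen a \<le> gen b"
proof -
  \<comment> \<open>Density and the feasible load \<open>a\<close> give a point of the dense set,
    which is interior.\<close>
  have "Omega_s_tilde net \<xi> f \<noteq> {}" using dense a by auto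
  then obtain c where c: "c \<in> interior \<Omega>" using tilde_interior by blast
  then have c': "c \<in> \<Omega>" using interior_subset[of \<Omega>] by blast
  define e where "e n = inverse (real (Suc n))" for n
  have e: "0 < e n" "e n \<le> 1" for n by (simp_all add: e_def inverse_le_1_iff)
  have e0: "e \<longlonglongrightarrow> 0" unfolding e_def by (rule LIMSEQ_inverse_real_of_nat)
  define P where "P x n = (1 - e n) *\<^sub>R x + e n *\<^sub>R c" for x n
  have P: "P x n \<in> interior \<Omega>" if "x \<in> \<Omega>" for x n
    using mem_interior_convex_shrink[OF convex_Omega c that e] by (simp add: P_def algebra_simps)
  have lim: "(\<lambda>n. gen (P x n)) \<longlonglongrightarrow> gen x" if x: "x \<in> \<Omega>" for x
  proof (rule gen_tendsto)
    show "P x n \<in> \<Omega>" for n using P[OF x] interior_subset[of \<Omega>] by blast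
    show "P x \<longlonglongrightarrow> x" unfolding P_def by (auto intro!: tendsto_eq_intros e0)
    \<comment> \<open>At a boundary point only this convexity bound is available, and it tends to
      the cost at \<open>x\<close>.\<close>
    show "f \<bullet> gen (P x n) \<le> (1 - e n) * (f \<bullet> gen x) + e n * (f \<bullet> gen c)" for n
      unfolding P_def using e[of n] x c' by (intro cost_convex) auto
    show "(\<lambda>n. (1 - e n) * (f \<bullet> gen x) + e n * (f \<bullet> gen c)) \<longlonglongrightarrow> f \<bullet> gen x"
      by (auto intro!: tendsto_eq_intros e0)
  qed (rule x)
  \<comment> \<open>Equal weights towards the common point \<open>c\<close> preserve the
    order.\<close>
  have "P a n \<le> P b n" for n
    using e[of n] \<open>a \<le> b\<close> by (auto simp: P_def less_eq_vec_def intro: mult_left_mono)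
  then have "gen (P a n) \<le> gen (P b n)" for n
    by (intro monotone_interior[OF dense SB P P] a b)
  then show ?thesis
    unfolding less_eq_vec_def
    by (auto intro!: LIMSEQ_le[OF tendsto_vec_nth[OF lim[OF a]] tendsto_vec_nth[OF lim[OF b]]])
qed

end

theorem theorem2:
  fixes net :: "('g::finite, 'l::finite, 'e::finite) power_net"
    and \<xi> :: "('g, 'e) limits"
    and f :: "real^'g"
  assumes "dc_network net"
    and "\<xi> \<in> Omega net"
    and "f \<in> Omega_f net \<xi>"
    and "regularity net \<xi> f"
  shows "(\<forall>sl \<in> Omega_s_tilde net \<xi> f.
            S_B net \<xi> f sl \<subseteq> bridges net \<longrightarrow> 0 \<le> dOPF net \<xi> f sl) \<and>
         ((\<forall>sl \<in> Omega_s_tilde net \<xi> f. S_B net \<xi> f sl \<subseteq> bridges net) \<longrightarrow>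
            monotone_system net \<xi> f)"
proof -
  interpret solvable_opf net \<xi> f using assms(1-3) by unfold_locales
  show ?thesis
    using assms(4) jacobian_nonneg tilde_interior gen_monotone
    unfolding regularity_def monotone_system_def by blast
qed

end
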